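(* Let $p_1>0$, $p_2\ne0$, $p_3>0$ with $p_1^2+p_2^2=p_3^2$, let $\Theta=\tan^{-1}\frac{p_1}{p_2+p_3}\in(0,\pi/2)$, let $p_4>0$ and $p_5=p_4\tan\Theta$, and let $\rho>0$. Consider the system $$\mathcal{D}'=2\mathcal{I}(p_1\mathcal{D}+(p_2-p_3)\mathcal{R})+2\rho p_5\mathcal{I},\qquad\mathcal{R}'=2\mathcal{I}(-(p_2+p_3)\mathcal{D}+p_1\mathcal{R})-2\rho p_4\mathcal{I},$$ $$\mathcal{I}'=-2p_1(\mathcal{D}^2+\mathcal{R}^2)+4p_3\mathcal{D}\mathcal{R}+2\rho(-p_5\mathcal{D}+p_4\mathcal{R})$$ on $S^2_\rho$. Let $$X=\tfrac{1}{2\sin\Theta}\mathcal{D}(0)+\tfrac{1}{2\cos\Theta}\mathcal{R}(0)+\tfrac{p_2p_4}{2p_1p_3\cos\Theta}\rho,\qquad Y=-\tfrac{1}{2\sin\Theta}\mathcal{D}(0)+\tfrac{1}{2\cos\Theta}\mathcal{R}(0)-\tfrac{p_4}{2p_1\cos\Theta}\rho,$$ $$r=\sqrt{\Big|\big(1-\tfrac{p_4^2}{4p_3^2\cos^2\Theta}\big)\rho^2-X^2\Big|},\qquad \mathcal{I}_0=\mathcal{I}(0).$$ Then the solution is given in the form $$\mathcal{D}(t)=\sin\Theta\Big(X-\tfrac{p_2p_4}{2p_1p_3\cos\Theta}\rho\Big)-\sin\Theta\,Z(t)-\tfrac{p_5}{2p_1}\rho,\qquad\mathcal{R}(t)=\cos\Theta\Big(X-\tfrac{p_2p_4}{2p_1p_3\cos\Theta}\rho\Big)+\cos\Theta\,Z(t)+\tfrac{p_4}{2p_1}\rho,$$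 where $Z(t)$ and $\mathcal{I}(t)$ are as follows. (1) If $X^2<\big(1-\frac{p_4^2}{4p_3^2\cos^2\Theta}\big)\rho^2$, then with $W(t)=((r-\mathcal{I}_0)^2+Y^2)e^{4p_1rt}+((r+\mathcal{I}_0)^2+Y^2)e^{-4p_1rt}-2\mathcal{I}_0^2-2Y^2+2r^2$, $$Z(t)=\tfrac{4r^2Y}{W(t)},\qquad\mathcal{I}(t)=-r\,\tfrac{((r-\mathcal{I}_0)^2+Y^2)e^{4p_1rt}-((r+\mathcal{I}_0)^2+Y^2)e^{-4p_1rt}}{W(t)}.$$ (2) If $X^2=\big(1-\frac{p_4^2}{4p_3^2\cos^2\Theta}\big)\rho^2$, then with $W(t)=(2p_1t(\mathcal{I}_0^2+Y^2)-\mathcal{I}_0)^2+Y^2$, $$Z(t)=\tfrac{(\mathcal{I}_0^2+Y^2)Y}{W(t)},\qquad\mathcal{I}(t)=-\tfrac{(\mathcal{I}_0^2+Y^2)(2p_1t(\mathcal{I}_0^2+Y^2)-\mathcal{I}_0)}{W(t)}.$$ (3) If $X^2>\big(1-\frac{p_4^2}{4p_3^2\cos^2\Theta}\big)\rho^2$, then with $W(t)=(\mathcal{I}_0^2+Y^2+r^2)-2r\mathcal{I}_0\sin(4p_1rt)-(\mathcal{I}_0^2+Y^2-r^2)\cos(4p_1rt)$, $$Z(t)=\tfrac{2r^2Y}{W(t)},\qquad\mathcal{I}(t)=r\,\tfrac{2r\mathcal{I}_0\cos(4p_1rt)-(\mathcal{I}_0^2+Y^2-r^2)\sin(4p_1r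t)}{W(t)}.$$
   Context: $S^2_\rho=\{(x,y,z)\in\mathbb{R}^3: x^2+y^2+z^2=\rho^2\}$; the unknown $(\mathcal{D},\mathcal{R},\mathcal{I})$ is real valued with initial data in $S_\rho^2$, and the system preserves $S^2_\rho$. In case (2), when $\mathcal{I}_0=Y=0$ (a fixed point) the fractions, formally $0/0$, are read as $0$. *)

theory Defs
  imports "HOL-Analysis.Analysis"
begin

definition S2 :: "real \<Rightarrow> (real \<times> real \<times> real) set" where
  "S2 \<rho> = {(x, y, z). x\<^sup>2 + y\<^sup>2 + z\<^sup>2 = \<rho>\<^sup>2}"

definition DRI_field ::
  "real \<Rightarrow> real \<Rightarrow> real \<Rightarrow> real \<Rightarrow> real \<Rightarrow> real \<Rightarrow> real \<times> real \<times> real \<Rightarrow> real \<times> real \<times> real" where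
  "DRI_field p1 p2 p3 p4 p5 \<rho> = (\<lambda>(D, R, I).
     (2 * I * (p1 * D + (p2 - p3) * R) + 2 * \<rho> * p5 * I,
      2 * I * (- (p2 + p3) * D + p1 * R) - 2 * \<rho> * p4 * I,
      - 2 * p1 * (D\<^sup>2 + R\<^sup>2) + 4 * p3 * D * R + 2 * \<rho> * (- p5 * D + p4 * R)))"

definition solution_on ::
  "('a::real_normed_vector \<Rightarrow> 'a) \<Rightarrow> real set \<Rightarrow> (real \<Rightarrow> 'a) \<Rightarrow> bool" where
  "solution_on F J \<gamma> \<longleftrightarrow> (\<forall>t\<in>J. (\<gamma> has_vector_derivative F (\<gamma> t)) (at t within J))"

(* \<gamma> is "the" solution of x' = F x, x(0) = q on the state space S: it exists for all real times,
   and every solution with the same initial value, on whatever time interval J around or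
   starting/ending at 0 (not assumed to remain in S), is a restriction of \<gamma>. *)
definition is_the_solution ::
  "('a::real_normed_vector \<Rightarrow> 'a) \<Rightarrow> 'a set \<Rightarrow> 'a \<Rightarrow> (real \<Rightarrow> 'a) \<Rightarrow> bool" where
  "is_the_solution F S q \<gamma> \<longleftrightarrow>
     \<gamma> 0 = q \<and> (\<forall>t. \<gamma> t \<in> S) \<and> solution_on F UNIV \<gamma> \<and>
     (\<forall>J \<eta>. is_interval J \<and> 0 \<in> J \<and> \<eta> 0 = q \<and> solution_on F J \<eta> \<longrightarrow> (\<forall>t\<in>J. \<eta> t = \<gamma> t))"

end

theory Submission
  imports Defs
begin

text \<open>
  In the coordinates \<open>x\<close>, \<open>z\<close> with \<open>D = sin \<Theta> * (x - b q - z - b)\<close> and \<open>R = cos \<Theta> * (x - b q + z + b)\<close>,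
  where \<open>b = p4 \<rho> / (2 p1 cos \<Theta>)\<close> and \<open>q = p2 / p3\<close>, the coordinate \<open>x\<close> is conserved, and on the
  sphere \<open>w = I + i z\<close> solves the complex Riccati equation \<open>w' = 2 p1 (w\<^sup>2 + X\<^sup>2 - K)\<close>.
  The three cases are its solutions for the three signs of \<open>X\<^sup>2 - K\<close>. The difference of two solutions
  and the defect from the sphere both satisfy scalar linear equations, so they vanish
  identically once they vanish at time 0.
\<close>

section \<open>Scalar linear equations and uniqueness for the Riccati system\<close>

text \<open>Integrating factor: if \<open>A\<close> is an antiderivative of \<open>a\<close>, then
  \<open>u * exp (- A)\<close> has derivative 0 and is therefore constant.\<close>

lemma linear_ode_zero:
  fixes a u :: "real \<Rightarrow> real"
  assumes J: "is_interval J" "t0 \<in> J" and a: "continuous_on J a"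
    and u: "\<And>t. t \<in> J \<Longrightarrow> (u has_vector_derivative a t * u t) (at t within J)"
    and u0: "u t0 = 0" and T: "T \<in> J"
  shows "u T = 0"
proof -
  \<comment> \<open>The compact segment between \<open>t0\<close> and \<open>T\<close>, in either
    order. On it \<open>a\<close> is integrable from the left end, whatever endpoints
    \<open>J\<close> has.\<close>
  define l where "l = min t0 T"
  define h where "h = max t0 T"
  have lh: "l \<in> J" "h \<in> J"
    using J(2) T by (simp_all add: l_def h_def min_def max_def)
  have sub: "{l..h} \<subseteq> J"
    using mem_is_interval_1_I[OF J(1) lh] by auto
  define A where "A = (\<lambda>t. integral {l..t} a)"
  have A: "(A has_field_derivative a t) (at t within {l..h})" if "t \<in> {l..h}" for t
    unfolding A_def has_real_derivative_iff_has_vector_derivative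
    using integral_has_vector_derivative[OF continuous_on_subset[OF a sub] that] .
  have u': "(u has_field_derivative a t * u t) (at t within {l..h})" if "t \<in> {l..h}" for t
    using has_vector_derivative_within_subset[OF u sub] that sub
    unfolding has_real_derivative_iff_has_vector_derivative by blast
  have "((\<lambda>t. u t * exp (- A t)) has_field_derivative 0) (at t within {l..h})"
    if "t \<in> {l..h}" for t
    by (rule DERIV_cong, (rule derivative_intros u'[OF that] A[OF that])+) (simp add: algebra_simps)
  then obtain k where "\<And>t. t \<in> {l..h} \<Longrightarrow> u t * exp (- A t) = k"
    using has_field_derivative_zero_constant[of "{l..h}" "\<lambda>t. u t * exp (- A t)"]
    by (auto simp: convex_real_interval)
  moreover have "t0 \<in> {l..h}" "T \<in> {l..h}"
    by (auto simp: l_def h_def)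
  ultimately have "u T * exp (- A T) = u t0 * exp (- A t0)"
    by metis
  with u0 show ?thesis by simp
qed

text \<open>Imaginary and real part of \<open>w' = 2 p (w\<^sup>2 + \<kappa>)\<close> for
  \<open>w = I + i Z\<close>.\<close>

definition riccati_on :: "real \<Rightarrow> real \<Rightarrow> real set \<Rightarrow> (real \<Rightarrow> real) \<Rightarrow> (real \<Rightarrow> real) \<Rightarrow> bool" where
  "riccati_on p \<kappa> J Z I \<longleftrightarrow> (\<forall>t\<in>J.
     (Z has_real_derivative 4 * p * I t * Z t) (at t within J) \<and>
     (I has_real_derivative 2 * p * ((I t)\<^sup>2 - (Z t)\<^sup>2 + \<kappa>)) (at t within J))"

lemma riccati_on_subset: "riccati_on p \<kappa> J Z I \<Longrightarrow> J' \<subseteq> J \<Longrightarrow> riccati_on p \<kappa> J' Z I"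
  unfolding riccati_on_def by (meson DERIV_subset subsetD)

lemma riccati_on_continuous: "riccati_on p \<kappa> J Z I \<Longrightarrow> continuous_on J I"
  unfolding riccati_on_def by (rule DERIV_continuous_on) blast

text \<open>For two solutions the difference \<open>d = w1 - w2\<close> satisfies
  \<open>d' = 2 p (w1 + w2) d\<close>. Hence \<open>u\<close>, the squared modulus of
  \<open>d\<close>, satisfies a real linear equation whose coefficient is twice the real part,
  \<open>4 p (I1 + I2)\<close>, and no Lipschitz estimate is involved.\<close>

lemma riccati_on_unique:
  assumes J: "is_interval J" "t0 \<in> J"
    and 1: "riccati_on p \<kappa> J Z1 I1" and 2: "riccati_on p \<kappa> J Z2 I2"
    and eq0: "Z1 t0 = Z2 t0" "I1 t0 = I2 t0" and t: "t \<in> J"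
  shows "Z1 t = Z2 t \<and> I1 t = I2 t"
proof -
  define u where "u = (\<lambda>t. (Z1 t - Z2 t)\<^sup>2 + (I1 t - I2 t)\<^sup>2)"
  have "u t = 0"
  proof (rule linear_ode_zero[OF J, where u = u and T = t and a = "\<lambda>t. 4 * p * (I1 t + I2 t)"])
    show "continuous_on J (\<lambda>t. 4 * p * (I1 t + I2 t))"
      by (intro continuous_intros riccati_on_continuous[OF 1] riccati_on_continuous[OF 2])
    show "(u has_vector_derivative 4 * p * (I1 t + I2 t) * u t) (at t within J)"
      if "t \<in> J" for t
    proof -
      from 1 that have d1: "(Z1 has_real_derivative 4 * p * I1 t * Z1 t) (at t within J)"
        "(I1 has_real_derivative 2 * p * ((I1 t)\<^sup>2 - (Z1 t)\<^sup>2 + \<kappa>)) (at t within J)"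
        by (auto simp: riccati_on_def)
      from 2 that have d2: "(Z2 has_real_derivative 4 * p * I2 t * Z2 t) (at t within J)"
        "(I2 has_real_derivative 2 * p * ((I2 t)\<^sup>2 - (Z2 t)\<^sup>2 + \<kappa>)) (at t within J)"
        by (auto simp: riccati_on_def)
      show ?thesis
        unfolding u_def has_real_derivative_iff_has_vector_derivative[symmetric]
        by (rule derivative_eq_intros d1 d2 refl)+ (simp; algebra)
    qed
  qed (use eq0 t in \<open>simp_all add: u_def\<close>)
  then show ?thesis
    by (simp add: u_def sum_power2_eq_zero_iff)
qed

section \<open>Closed-form solutions of the Riccati system for each sign of \<kappa>\<close>

text \<open>
  The equation for \<open>Z = k / W\<close> forces \<open>I = - W' / (4 p W)\<close>; the remaining equation is
  the quadratic identity below.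
\<close>

lemma riccati_onI:
  fixes W W' W'' :: "real \<Rightarrow> real"
  assumes p: "p \<noteq> 0"
    and nz: "\<And>t. W t \<noteq> 0"
    and W: "\<And>t. (W has_real_derivative W' t) (at t)"
    and W': "\<And>t. (W' has_real_derivative W'' t) (at t)"
    and key: "\<And>t. W'' t * W t - (W' t)\<^sup>2 / 2 = 8 * p\<^sup>2 * (k\<^sup>2 - \<kappa> * (W t)\<^sup>2)"
    and Z: "\<And>t. Z t = k / W t" and I: "\<And>t. I t = - W' t / (4 * p * W t)"
  shows "riccati_on p \<kappa> UNIV Z I"
proof -
  have eqs: "Z = (\<lambda>t. k / W t)" "I = (\<lambda>t. - W' t / (4 * p * W t))"
    using Z I by auto
  have "(Z has_real_derivative 4 * p * I t * Z t) (at t)" for t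
    unfolding eqs
    by (rule derivative_eq_intros W nz refl)+
      (use p nz[of t] in \<open>simp add: field_simps power2_eq_square\<close>)
  moreover have "(I has_real_derivative 2 * p * ((I t)\<^sup>2 - (Z t)\<^sup>2 + \<kappa>)) (at t)" for t
  proof -
    \<comment> \<open>Eliminating the second derivative leaves a rational identity in
      \<open>W\<close> and \<open>W'\<close> after the quotient rule.\<close>
    have W'': "W'' t = ((W' t)\<^sup>2 / 2 + 8 * p\<^sup>2 * (k\<^sup>2 - \<kappa> * (W t)\<^sup>2)) / W t"
      using key[of t] nz[of t] by (simp add: field_simps)
    show ?thesis
      unfolding eqs
      apply (rule derivative_eq_intros W W' refl)+
      subgoal using p nz[of t] by simp
      subgoal unfolding W'' using p nz[of t] by (simp add: field_simps power2_eq_square)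
      done
  qed
  ultimately show ?thesis
    by (simp add: riccati_on_def)
qed

text \<open>Here the equilibria are \<open>w = r\<close> and \<open>w = - r\<close>. The condition
  on \<open>Y = 0\<close> excludes real solutions that blow up: for \<open>Y = 0\<close> and
  \<open>I0\<^sup>2 > r\<^sup>2\<close> the denominator \<open>W\<close> has a zero.\<close>

lemma riccati_on_negative:
  fixes p r I0 Y :: real
  defines "W \<equiv> (\<lambda>t. ((r - I0)\<^sup>2 + Y\<^sup>2) * exp (4 * p * r * t)
             + ((r + I0)\<^sup>2 + Y\<^sup>2) * exp (- 4 * p * r * t) - 2 * I0\<^sup>2 - 2 * Y\<^sup>2 + 2 * r\<^sup>2)"
  assumes p: "p \<noteq> 0" and r: "r > 0" and Y0: "Y = 0 \<Longrightarrow> I0\<^sup>2 = r\<^sup>2"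
  shows "riccati_on p (- r\<^sup>2) UNIV (\<lambda>t. 4 * r\<^sup>2 * Y / W t)
    (\<lambda>t. - r * ((((r - I0)\<^sup>2 + Y\<^sup>2) * exp (4 * p * r * t)
            - ((r + I0)\<^sup>2 + Y\<^sup>2) * exp (- 4 * p * r * t)) / W t))"
proof -
  define A where "A = (r - I0)\<^sup>2 + Y\<^sup>2"
  define B where "B = (r + I0)\<^sup>2 + Y\<^sup>2"
  define M where "M = I0\<^sup>2 + Y\<^sup>2 - r\<^sup>2"
  have W: "W t = A * exp (4 * p * r * t) + B * exp (- 4 * p * r * t) - 2 * M" for t
    by (simp add: W_def A_def B_def M_def)
  \<comment> \<open>With \<open>w0 = I0 + i Y\<close>, \<open>A\<close> and \<open>B\<close> are the
    squared moduli of \<open>w0 - r\<close> and \<open>w0 + r\<close>, so \<open>A * B\<close> is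
    that of \<open>w0\<^sup>2 - r\<^sup>2\<close>.\<close>
  have AB: "A * B = M\<^sup>2 + 4 * r\<^sup>2 * Y\<^sup>2"
    unfolding A_def B_def M_def by algebra
  have ee: "exp (4 * p * r * t) * exp (- 4 * p * r * t) = 1" for t
    by (simp flip: exp_add)
  have nonneg: "A \<ge> 0" "B \<ge> 0"
    by (simp_all add: A_def B_def)
  have nz: "W t \<noteq> 0" for t
  proof (cases "Y = 0")
    case True
    with Y0 have "I0 = r \<or> I0 = - r" by (simp add: power2_eq_iff)
    with True r show ?thesis
      by (auto simp: W A_def B_def M_def)
  next
    case False
    \<comment> \<open>Arithmetic-geometric mean inequality: the two exponentials have product 1, so
      \<open>S\<^sup>2\<close> is at least \<open>4 A B\<close>, which exceeds
      \<open>(2 M)\<^sup>2\<close> strictly because \<open>Y\<close> is nonzero.\<close>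
    define S where "S = A * exp (4 * p * r * t) + B * exp (- 4 * p * r * t)"
    have "S\<^sup>2 - 4 * (A * B) * (exp (4 * p * r * t) * exp (- 4 * p * r * t))
        = (A * exp (4 * p * r * t) - B * exp (- 4 * p * r * t))\<^sup>2"
      unfolding S_def by algebra
    then have "S\<^sup>2 \<ge> 4 * (A * B)"
      unfolding ee using zero_le_power2[of "A * exp (4 * p * r * t) - B * exp (- 4 * p * r * t)"] by linarith
    moreover have "4 * (A * B) > (2 * M)\<^sup>2"
      using False r by (simp add: AB power_mult_distrib)
    ultimately have "S \<noteq> 2 * M" by auto
    then show ?thesis by (simp add: W S_def)
  qed
  show ?thesis
    unfolding A_def[symmetric] B_def[symmetric]
  proof (rule riccati_onI[where W = W and k = "4 * r\<^sup>2 * Y"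
        and W' = "\<lambda>t. 4 * p * r * (A * exp (4 * p * r * t) - B * exp (- 4 * p * r * t))"
        and W'' = "\<lambda>t. 16 * p\<^sup>2 * r\<^sup>2 * (A * exp (4 * p * r * t) + B * exp (- 4 * p * r * t))"])
    fix t
    show "(W has_real_derivative 4 * p * r * (A * exp (4 * p * r * t) - B * exp (- 4 * p * r * t))) (at t)"
      unfolding W[abs_def]
      by (rule derivative_eq_intros refl)+ (simp add: algebra_simps)
    show "((\<lambda>t. 4 * p * r * (A * exp (4 * p * r * t) - B * exp (- 4 * p * r * t))) has_real_derivative
        16 * p\<^sup>2 * r\<^sup>2 * (A * exp (4 * p * r * t) + B * exp (- 4 * p * r * t))) (at t)"
      by (rule derivative_eq_intros refl)+ (simp add: algebra_simps power2_eq_square)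
    show "16 * p\<^sup>2 * r\<^sup>2 * (A * exp (4 * p * r * t) + B * exp (- 4 * p * r * t)) * W t
        - (4 * p * r * (A * exp (4 * p * r * t) - B * exp (- 4 * p * r * t)))\<^sup>2 / 2
        = 8 * p\<^sup>2 * ((4 * r\<^sup>2 * Y)\<^sup>2 - - r\<^sup>2 * (W t)\<^sup>2)"
      using AB ee[of t] unfolding W by algebra
  qed (use p nz in \<open>auto simp: field_simps\<close>)
qed

text \<open>The equation \<open>w' = 2 p w\<^sup>2\<close> makes \<open>1 / w\<close> affine in
  time. Inverting \<open>1 / w0 - 2 p t\<close> and making the denominator real gives these
  fractions.\<close>

lemma riccati_on_zero:
  fixes p I0 Y :: real
  defines "W \<equiv> (\<lambda>t. (2 * p * t * (I0\<^sup>2 + Y\<^sup>2) - I0)\<^sup>2 + Y\<^sup>2)"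
  assumes p: "p \<noteq> 0" and Y0: "Y = 0 \<Longrightarrow> I0 = 0"
  shows "riccati_on p 0 UNIV (\<lambda>t. (I0\<^sup>2 + Y\<^sup>2) * Y / W t)
    (\<lambda>t. - ((I0\<^sup>2 + Y\<^sup>2) * (2 * p * t * (I0\<^sup>2 + Y\<^sup>2) - I0) / W t))"
proof (cases "Y = 0")
  case True
  \<comment> \<open>The fixed point: both fractions are 0/0, which evaluates to 0, so both functions
    are constantly 0.\<close>
  with Y0 show ?thesis by (simp add: riccati_on_def)
next
  case False
  define M where "M = I0\<^sup>2 + Y\<^sup>2"
  have W: "W t = (2 * p * t * M - I0)\<^sup>2 + Y\<^sup>2" for t
    by (simp add: W_def M_def)
  have nz: "W t \<noteq> 0" for t
    using False by (simp add: W sum_power2_eq_zero_iff)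
  show ?thesis
    unfolding M_def[symmetric]
  proof (rule riccati_onI[where W = W and k = "M * Y"
        and W' = "\<lambda>t. 4 * p * M * (2 * p * t * M - I0)" and W'' = "\<lambda>t. 8 * p\<^sup>2 * M\<^sup>2"])
    fix t
    show "(W has_real_derivative 4 * p * M * (2 * p * t * M - I0)) (at t)"
      unfolding W[abs_def]
      by (rule derivative_eq_intros refl)+ (simp add: algebra_simps)
    show "((\<lambda>t. 4 * p * M * (2 * p * t * M - I0)) has_real_derivative 8 * p\<^sup>2 * M\<^sup>2) (at t)"
      by (rule derivative_eq_intros refl)+ (simp add: algebra_simps power2_eq_square)
    show "8 * p\<^sup>2 * M\<^sup>2 * W t - (4 * p * M * (2 * p * t * M - I0))\<^sup>2 / 2
        = 8 * p\<^sup>2 * ((M * Y)\<^sup>2 - 0 * (W t)\<^sup>2)"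
      unfolding W by algebra
  qed (use p nz in \<open>auto simp: field_simps\<close>)
qed

text \<open>The equilibria are now \<open>w = i r\<close> and \<open>w = - i r\<close>, off the real
  axis. For nonzero \<open>Y\<close> the oscillating part of \<open>W\<close> has amplitude strictly
  below its mean \<open>P\<close>, so \<open>W\<close> has no zero.\<close>

lemma riccati_on_positive:
  fixes p r I0 Y :: real
  defines "W \<equiv> (\<lambda>t. (I0\<^sup>2 + Y\<^sup>2 + r\<^sup>2) - 2 * r * I0 * sin (4 * p * r * t)
             - (I0\<^sup>2 + Y\<^sup>2 - r\<^sup>2) * cos (4 * p * r * t))"
  assumes p: "p \<noteq> 0" and r: "r > 0" and Y: "Y \<noteq> 0"
  shows "riccati_on p (r\<^sup>2) UNIV (\<lambda>t. 2 * r\<^sup>2 * Y / W t)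
    (\<lambda>t. r * ((2 * r * I0 * cos (4 * p * r * t)
            - (I0\<^sup>2 + Y\<^sup>2 - r\<^sup>2) * sin (4 * p * r * t)) / W t))"
proof -
  define P where "P = I0\<^sup>2 + Y\<^sup>2 + r\<^sup>2"
  define N where "N = I0\<^sup>2 + Y\<^sup>2 - r\<^sup>2"
  define C where "C = 2 * r * I0"
  have W: "W t = P - C * sin (4 * p * r * t) - N * cos (4 * p * r * t)" for t
    by (simp add: W_def P_def N_def C_def)
  have PN: "C\<^sup>2 + N\<^sup>2 = P\<^sup>2 - 4 * r\<^sup>2 * Y\<^sup>2"
    unfolding P_def N_def C_def by algebra
  have nz: "W t \<noteq> 0" for t
  proof
    assume "W t = 0"
    \<comment> \<open>A zero of \<open>W\<close> means \<open>P = C sin + N cos\<close>. Adding the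
      square of the rotated combination \<open>C cos - N sin\<close> gives
      \<open>C\<^sup>2 + N\<^sup>2\<close>, which \<open>PN\<close> makes smaller than
      \<open>P\<^sup>2\<close>.\<close>
    then have "P\<^sup>2 + (C * cos (4 * p * r * t) - N * sin (4 * p * r * t))\<^sup>2 = C\<^sup>2 + N\<^sup>2"
      using sin_cos_squared_add[of "4 * p * r * t"] unfolding W by algebra
    moreover have "r\<^sup>2 * Y\<^sup>2 > 0"
      using r Y by simp
    ultimately show False
      using PN zero_le_power2[of "C * cos (4 * p * r * t) - N * sin (4 * p * r * t)"] by linarith
  qed
  show ?thesis
    unfolding C_def[symmetric] N_def[symmetric]
  proof (rule riccati_onI[where W = W and k = "2 * r\<^sup>2 * Y"
        and W' = "\<lambda>t. - 4 * p * r * (C * cos (4 * p * r * t) - N * sin (4 * p * r * t))"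
        and W'' = "\<lambda>t. 16 * p\<^sup>2 * r\<^sup>2 * (C * sin (4 * p * r * t) + N * cos (4 * p * r * t))"])
    fix t
    show "(W has_real_derivative - 4 * p * r * (C * cos (4 * p * r * t) - N * sin (4 * p * r * t))) (at t)"
      unfolding W[abs_def]
      by (rule derivative_eq_intros refl)+ (simp add: algebra_simps)
    show "((\<lambda>t. - 4 * p * r * (C * cos (4 * p * r * t) - N * sin (4 * p * r * t))) has_real_derivative
        16 * p\<^sup>2 * r\<^sup>2 * (C * sin (4 * p * r * t) + N * cos (4 * p * r * t))) (at t)"
      by (rule derivative_eq_intros refl)+ (simp add: algebra_simps power2_eq_square)
    show "16 * p\<^sup>2 * r\<^sup>2 * (C * sin (4 * p * r * t) + N * cos (4 * p * r * t)) * W t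
        - (- 4 * p * r * (C * cos (4 * p * r * t) - N * sin (4 * p * r * t)))\<^sup>2 / 2
        = 8 * p\<^sup>2 * ((2 * r\<^sup>2 * Y)\<^sup>2 - r\<^sup>2 * (W t)\<^sup>2)"
      using PN sin_cos_squared_add[of "4 * p * r * t"] unfolding W by algebra
  qed (use p nz in \<open>auto simp: field_simps\<close>)
qed

section \<open>The vector field and the sphere in the coordinates \<open>x\<close>,
  \<open>z\<close>\<close>

lemma has_vector_derivative_Pair_iff:
  "((\<lambda>t. (f t, g t)) has_vector_derivative (f', g')) (at t within J) \<longleftrightarrow>
    (f has_vector_derivative f') (at t within J) \<and> (g has_vector_derivative g') (at t within J)"
  using bounded_linear.has_vector_derivative[OF bounded_linear_fst, of "\<lambda>t. (f t, g t)" "(f', g')"]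
    bounded_linear.has_vector_derivative[OF bounded_linear_snd, of "\<lambda>t. (f t, g t)" "(f', g')"]
  by (auto intro: has_vector_derivative_Pair)

lemma solution_on_DRI_field_iff:
  "solution_on (DRI_field p1 p2 p3 p4 p5 \<rho>) J (\<lambda>t. (D t, R t, I t)) \<longleftrightarrow> (\<forall>t\<in>J.
     (D has_real_derivative 2 * I t * (p1 * D t + (p2 - p3) * R t) + 2 * \<rho> * p5 * I t) (at t within J) \<and>
     (R has_real_derivative 2 * I t * (- (p2 + p3) * D t + p1 * R t) - 2 * \<rho> * p4 * I t) (at t within J) \<and>
     (I has_real_derivative - 2 * p1 * ((D t)\<^sup>2 + (R t)\<^sup>2) + 4 * p3 * D t * R t
        + 2 * \<rho> * (- p5 * D t + p4 * R t)) (at t within J))"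
  by (simp add: solution_on_def DRI_field_def has_vector_derivative_Pair_iff
      has_real_derivative_iff_has_vector_derivative)

locale dri =
  fixes p1 p2 p3 p4 p5 \<Theta> \<rho> D0 R0 I0 X Y K :: real
  assumes p1: "p1 > 0" and p3: "p3 > 0" and pp: "p1\<^sup>2 + p2\<^sup>2 = p3\<^sup>2"
    and Theta: "\<Theta> = arctan (p1 / (p2 + p3))"
    and p5: "p5 = p4 * tan \<Theta>"
    and init: "(D0, R0, I0) \<in> S2 \<rho>"
    and X: "X = 1 / (2 * sin \<Theta>) * D0 + 1 / (2 * cos \<Theta>) * R0 + p2 * p4 / (2 * p1 * p3 * cos \<Theta>) * \<rho>"
    and Y: "Y = - (1 / (2 * sin \<Theta>)) * D0 + 1 / (2 * cos \<Theta>) * R0 - p4 / (2 * p1 * cos \<Theta>) * \<rho>"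
    and K: "K = (1 - p4\<^sup>2 / (4 * p3\<^sup>2 * (cos \<Theta>)\<^sup>2)) * \<rho>\<^sup>2"
begin

abbreviation s where "s \<equiv> sin \<Theta>"
abbreviation c where "c \<equiv> cos \<Theta>"

definition b where "b = p4 * \<rho> / (2 * p1 * c)"
definition q where "q = p2 / p3"
text \<open>Half the coefficient of \<open>z\<close> in the equation of the sphere cut by the plane
  \<open>x = X\<close>.\<close>

definition \<beta> where "\<beta> = b + (X - b * q) * q"

definition Dof where "Dof x z = s * (x - b * q - z - b)"
definition Rof where "Rof x z = c * (x - b * q + z + b)"
definition xof where "xof D R = D / (2 * s) + R / (2 * c) + b * q"
definition zof where "zof D R = R / (2 * c) - D / (2 * s) - b"

lemma p23: "p2 + p3 > 0"
proof -
  have "- p2 < p3"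
    by (rule power2_less_imp_less) (use pp p1 p3 in \<open>simp_all flip: pp\<close>)
  then show ?thesis by simp
qed

lemma s_pos: "s > 0" and c_pos: "c > 0"
proof -
  have "0 < \<Theta>" "\<Theta> < pi / 2"
    using p1 p23 arctan_ubound by (auto simp: Theta)
  then show "s > 0" "c > 0"
    by (auto intro: sin_gt_zero cos_gt_zero)
qed

text \<open>Half-angle formula: \<open>sc3\<close> and \<open>q\<close> below say
  \<open>p1 = p3 sin 2\<Theta>\<close> and \<open>p2 = p3 cos 2\<Theta>\<close>. The relations are
  kept polynomial in \<open>s\<close> and \<open>c\<close> for use by
  \<open>algebra\<close>.\<close>

lemma sc1: "p1 * c = (p2 + p3) * s"
proof -
  have "s / c = p1 / (p2 + p3)"
    using tan_arctan[of "p1 / (p2 + p3)"] by (simp add: Theta tan_def)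
  then show ?thesis using c_pos p23 by (simp add: field_simps)
qed

lemma sc2: "p1 * s = (p3 - p2) * c"
proof -
  have "(p2 + p3) * (p1 * s) = (p2 + p3) * ((p3 - p2) * c)"
    using sc1 pp by algebra
  then show ?thesis using p23 by simp
qed

lemma sc3: "2 * p3 * s * c = p1"
  using sc1 sc2 sin_cos_squared_add[of \<Theta>] by algebra

lemma q: "c\<^sup>2 - s\<^sup>2 = q"
proof -
  have "p3 * (c\<^sup>2 - s\<^sup>2) = p2"
    using sc1 sc2 sc3 pp sin_cos_squared_add[of \<Theta>] p1 by algebra
  then show ?thesis using p3 by (simp add: q_def field_simps)
qed

lemma p4_rho: "p4 * \<rho> = 2 * p1 * c * b" and p5_rho: "p5 * \<rho> = 2 * p1 * s * b"
  using p1 c_pos by (simp_all add: b_def p5 tan_def)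

lemma K_eq: "K = \<rho>\<^sup>2 - b\<^sup>2 * (1 - q\<^sup>2)"
proof -
  have q1: "1 - q\<^sup>2 = p1\<^sup>2 / p3\<^sup>2"
    using pp p3 by (simp add: q_def field_simps)
  show ?thesis
    unfolding K q1 b_def using p1 p3 c_pos by (simp add: field_simps power2_eq_square)
qed

lemma X_eq: "X = xof D0 R0" and Y_eq: "Y = zof D0 R0"
  by (simp_all add: X Y xof_def zof_def b_def q_def mult_ac)

lemma Dof_xof: "Dof (xof D R) (zof D R) = D" and Rof_xof: "Rof (xof D R) (zof D R) = R"
  using s_pos c_pos by (simp_all add: Dof_def Rof_def xof_def zof_def field_simps)

lemma Dof_init: "Dof X Y = D0" and Rof_init: "Rof X Y = R0"
  by (simp_all add: X_eq Y_eq Dof_xof Rof_xof)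

lemma Dof_eq: "s * (X - p2 * p4 / (2 * p1 * p3 * c) * \<rho>) - s * z - p5 / (2 * p1) * \<rho> = Dof X z"
  and Rof_eq: "c * (X - p2 * p4 / (2 * p1 * p3 * c) * \<rho>) + c * z + p4 / (2 * p1) * \<rho> = Rof X z"
proof -
  have "p2 * p4 / (2 * p1 * p3 * c) * \<rho> = b * q" "p5 / (2 * p1) * \<rho> = s * b" "p4 / (2 * p1) * \<rho> = c * b"
    using p1 c_pos p4_rho p5_rho by (simp_all add: b_def q_def mult_ac)
  then show "s * (X - p2 * p4 / (2 * p1 * p3 * c) * \<rho>) - s * z - p5 / (2 * p1) * \<rho> = Dof X z"
    "c * (X - p2 * p4 / (2 * p1 * p3 * c) * \<rho>) + c * z + p4 / (2 * p1) * \<rho> = Rof X z"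
    by (simp_all only: Dof_def Rof_def) (simp_all add: algebra_simps)
qed

text \<open>The shift of \<open>x\<close> by \<open>b q\<close> completes the square: at
  \<open>z = 0\<close> the terms linear in \<open>X\<close> cancel and
  \<open>X\<^sup>2 + b\<^sup>2 (1 - q\<^sup>2)\<close> remains, which is where \<open>K\<close>
  comes from.\<close>

lemma norm_eq: "(Dof X z)\<^sup>2 + (Rof X z)\<^sup>2 = \<rho>\<^sup>2 + X\<^sup>2 - K + z\<^sup>2 + 2 * z * \<beta>"
proof -
  have "(s * (u - v - b))\<^sup>2 + (c * (u + v + b))\<^sup>2
      = (s\<^sup>2 + c\<^sup>2) * (u\<^sup>2 + (v + b)\<^sup>2) + 2 * (c\<^sup>2 - s\<^sup>2) * u * (v + b)" for u v b
    by algebra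
  from this[of "X - b * q" z b] show ?thesis
    unfolding Dof_def Rof_def \<beta>_def K_eq q sin_cos_squared_add
    by (simp add: algebra_simps power2_eq_square)
qed

lemma sphere_iff: "(Dof X z, Rof X z, i) \<in> S2 \<rho> \<longleftrightarrow> i\<^sup>2 + z\<^sup>2 + 2 * z * \<beta> + (X\<^sup>2 - K) = 0"
  using norm_eq[of z] by (auto simp: S2_def)

lemma init_eq: "I0\<^sup>2 + Y\<^sup>2 + 2 * Y * \<beta> + (X\<^sup>2 - K) = 0"
  using init sphere_iff[of Y I0] by (simp add: Dof_init Rof_init)

text \<open>By \<open>sc2\<close> the terms in \<open>x\<close> cancel, and the shift of
  \<open>z\<close> by \<open>b\<close> absorbs the \<open>p5\<close> term. \<open>R_field\<close>
  gives the same factor \<open>4 p1 i z\<close> with \<open>c\<close> in place of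
  \<open>- s\<close>, hence the conservation of \<open>x\<close>. Both hold off the sphere
  too.\<close>

lemma D_field: "2 * i * (p1 * Dof x z + (p2 - p3) * Rof x z) + 2 * \<rho> * p5 * i = - s * (4 * p1 * i * z)"
  using sc2 p5_rho unfolding Dof_def Rof_def by algebra

lemma R_field: "2 * i * (- (p2 + p3) * Dof x z + p1 * Rof x z) - 2 * \<rho> * p4 * i = c * (4 * p1 * i * z)"
  using sc1 p4_rho unfolding Dof_def Rof_def by algebra

text \<open>On the sphere the sum of squares can be traded for
  \<open>\<rho>\<^sup>2 - i\<^sup>2\<close>, which produces the \<open>i\<^sup>2\<close> of the
  Riccati equation. The terms linear in \<open>z\<close> from the product and from the \<rho> part
  cancel.\<close>

lemma I_field_norm:
  "i\<^sup>2 + z\<^sup>2 + 2 * z * \<beta> + (X\<^sup>2 - K) = 0 \<Longrightarrow>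
    - 2 * p1 * ((Dof X z)\<^sup>2 + (Rof X z)\<^sup>2) + 4 * p3 * Dof X z * Rof X z
      + 2 * \<rho> * (- p5 * Dof X z + p4 * Rof X z) = 2 * p1 * (i\<^sup>2 - z\<^sup>2 + (X\<^sup>2 - K))"
proof -
  assume *: "i\<^sup>2 + z\<^sup>2 + 2 * z * \<beta> + (X\<^sup>2 - K) = 0"
  have "4 * p3 * Dof X z * Rof X z = 2 * p1 * ((X - b * q)\<^sup>2 - (z + b)\<^sup>2)"
  proof -
    have "4 * p3 * (s * (u - b - v)) * (c * (u + v + b)) = 2 * (2 * p3 * s * c) * (u\<^sup>2 - (v + b)\<^sup>2)" for u v b
      by algebra
    from this[of "X - b * q" z b] show ?thesis
      unfolding Dof_def Rof_def sc3 by (simp add: algebra_simps)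
  qed
  moreover have "2 * \<rho> * (- p5 * Dof X z + p4 * Rof X z) = 4 * p1 * b * ((X - b * q) * q + z + b)"
    using p4_rho p5_rho q sin_cos_squared_add[of \<Theta>] unfolding Dof_def Rof_def by algebra
  ultimately show ?thesis
    using * unfolding norm_eq K_eq \<beta>_def by algebra
qed

section \<open>Passing between the system on the sphere and the Riccati equation\<close>

text \<open>This direction serves uniqueness, so staying on the sphere is derived and not
  assumed.\<close>

lemma riccati_of_solution:
  assumes J: "is_interval J" "0 \<in> J" and sol: "solution_on (DRI_field p1 p2 p3 p4 p5 \<rho>) J (\<lambda>t. (D t, R t, I t))"
    and 0: "D 0 = D0" "R 0 = R0" "I 0 = I0"
  shows "riccati_on p1 (X\<^sup>2 - K) J (\<lambda>t. zof (D t) (R t)) I"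
    and "t \<in> J \<Longrightarrow> xof (D t) (R t) = X"
proof -
  define x where "x t = xof (D t) (R t)" for t
  define z where "z t = zof (D t) (R t)" for t
  have D: "D t = Dof (x t) (z t)" and R: "R t = Rof (x t) (z t)" for t
    by (simp_all add: x_def z_def Dof_xof Rof_xof)
  note sol = sol[unfolded solution_on_DRI_field_iff]
  have D': "(D has_real_derivative - s * (4 * p1 * I t * z t)) (at t within J)"
    and R': "(R has_real_derivative c * (4 * p1 * I t * z t)) (at t within J)" if "t \<in> J" for t
    using sol[rule_format, OF that] D_field[of "I t" "x t" "z t"] R_field[of "I t" "x t" "z t"]
    by (simp_all flip: D R)
  have I': "(I has_real_derivative - 2 * p1 * ((D t)\<^sup>2 + (R t)\<^sup>2) + 4 * p3 * D t * R t
        + 2 * \<rho> * (- p5 * D t + p4 * R t)) (at t within J)" if "t \<in> J" for t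
    using sol that by blast
  have const: "f t = f 0"
    if "\<And>t. t \<in> J \<Longrightarrow> (f has_real_derivative 0) (at t within J)" "t \<in> J" for f t
    using has_field_derivative_zero_constant[of J f] that J is_interval_convex by metis
  have z': "(z has_real_derivative 4 * p1 * I t * z t) (at t within J)" if "t \<in> J" for t
    unfolding z_def[abs_def] zof_def
    by (rule DERIV_cong[OF DERIV_diff[OF DERIV_diff[OF DERIV_cdivide[OF R'] DERIV_cdivide[OF D']] DERIV_const]])
      (use that s_pos c_pos in \<open>simp_all add: z_def zof_def\<close>)
  have x: "x t = X" if "t \<in> J" for t
  proof -
    have "(x has_real_derivative 0) (at t within J)" if "t \<in> J" for t
      unfolding x_def[abs_def] xof_def
      by (rule DERIV_cong[OF DERIV_add[OF DERIV_add[OF DERIV_cdivide[OF D'] DERIV_cdivide[OF R']] DERIV_const]])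
        (use that s_pos c_pos in simp_all)
    from const[OF this \<open>t \<in> J\<close>] show ?thesis
      by (simp add: x_def 0 X_eq)
  qed
  then show "t \<in> J \<Longrightarrow> xof (D t) (R t) = X"
    by (simp add: x_def)
  have sphere: "(D t)\<^sup>2 + (R t)\<^sup>2 + (I t)\<^sup>2 = \<rho>\<^sup>2" if "t \<in> J" for t
  proof -
    \<comment> \<open>The field is orthogonal to the position vector, so the norm is
      conserved.\<close>
    have "((\<lambda>t. (D t)\<^sup>2 + (R t)\<^sup>2 + (I t)\<^sup>2) has_real_derivative 0) (at t within J)" if t: "t \<in> J" for t
      using sol[rule_format, OF t]
      apply (elim conjE)
      apply (rule derivative_eq_intros refl | assumption)+
      apply (simp; algebra)
      done
    from const[OF this \<open>t \<in> J\<close>] show ?thesis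
      using init by (simp add: 0 S2_def)
  qed
  have "(I has_real_derivative 2 * p1 * ((I t)\<^sup>2 - (z t)\<^sup>2 + (X\<^sup>2 - K))) (at t within J)" if "t \<in> J" for t
  proof -
    have "(Dof X (z t), Rof X (z t), I t) \<in> S2 \<rho>"
      using sphere[OF that] x[OF that] by (simp add: S2_def D R)
    from I_field_norm[OF this[unfolded sphere_iff]] I'[OF that] show ?thesis
      by (simp add: D R x[OF that])
  qed
  with z' show "riccati_on p1 (X\<^sup>2 - K) J (\<lambda>t. zof (D t) (R t)) I"
    by (simp add: riccati_on_def flip: z_def)
qed

text \<open>Existence and uniqueness for the original system reduce to a global Riccati solution
  with the right initial values.\<close>

lemma solution_of_riccati:
  assumes ric: "riccati_on p1 (X\<^sup>2 - K) UNIV Z I" and 0: "Z 0 = Y" "I 0 = I0"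
  shows "is_the_solution (DRI_field p1 p2 p3 p4 p5 \<rho>) (S2 \<rho>) (D0, R0, I0) (\<lambda>t. (Dof X (Z t), Rof X (Z t), I t))"
proof -
  from ric have Z': "(Z has_real_derivative 4 * p1 * I t * Z t) (at t)"
    and I': "(I has_real_derivative 2 * p1 * ((I t)\<^sup>2 - (Z t)\<^sup>2 + (X\<^sup>2 - K))) (at t)" for t
    by (simp_all add: riccati_on_def)
  \<comment> \<open>\<open>I_field_norm\<close> applies only on the sphere. The defect from it
    vanishes at time 0 by \<open>init_eq\<close> and satisfies a linear equation with coefficient
    \<open>4 p1 I\<close>.\<close>
  have sphere: "(I t)\<^sup>2 + (Z t)\<^sup>2 + 2 * Z t * \<beta> + (X\<^sup>2 - K) = 0" for t
  proof (rule linear_ode_zero[where J = UNIV and ?t0.0 = 0 and a = "\<lambda>t. 4 * p1 * I t"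
        and T = t and u = "\<lambda>t. (I t)\<^sup>2 + (Z t)\<^sup>2 + 2 * Z t * \<beta> + (X\<^sup>2 - K)"])
    show "continuous_on UNIV (\<lambda>t. 4 * p1 * I t)"
      by (intro continuous_intros riccati_on_continuous[OF ric])
    show "((\<lambda>t. (I t)\<^sup>2 + (Z t)\<^sup>2 + 2 * Z t * \<beta> + (X\<^sup>2 - K)) has_vector_derivative
        4 * p1 * I t * ((I t)\<^sup>2 + (Z t)\<^sup>2 + 2 * Z t * \<beta> + (X\<^sup>2 - K))) (at t within UNIV)" for t
      unfolding has_real_derivative_iff_has_vector_derivative[symmetric]
      by (rule derivative_eq_intros Z' I' refl)+ (simp; algebra)
  qed (use init_eq in \<open>simp_all add: 0\<close>)
  have "solution_on (DRI_field p1 p2 p3 p4 p5 \<rho>) UNIV (\<lambda>t. (Dof X (Z t), Rof X (Z t), I t))"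
    unfolding solution_on_DRI_field_iff D_field R_field
  proof (intro ballI conjI)
    fix t
    show "((\<lambda>t. Dof X (Z t)) has_real_derivative - s * (4 * p1 * I t * Z t)) (at t)"
      unfolding Dof_def by (rule derivative_eq_intros Z' refl)+ simp
    show "((\<lambda>t. Rof X (Z t)) has_real_derivative c * (4 * p1 * I t * Z t)) (at t)"
      unfolding Rof_def by (rule derivative_eq_intros Z' refl)+ simp
  qed (use I' I_field_norm[OF sphere] in simp)
  \<comment> \<open>A competitor \<open>\<eta>\<close> yields a Riccati solution with the same
    initial values, hence the same \<open>z\<close> and \<open>I\<close>; together with
    \<open>x = X\<close> these determine \<open>D\<close> and \<open>R\<close>.\<close>
  moreover have "\<eta> t = (Dof X (Z t), Rof X (Z t), I t)"
    if J: "is_interval J" "0 \<in> J" and \<eta>: "\<eta> 0 = (D0, R0, I0)"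
      "solution_on (DRI_field p1 p2 p3 p4 p5 \<rho>) J \<eta>" and t: "t \<in> J" for J \<eta> t
  proof -
    define D where "D t = fst (\<eta> t)" for t
    define R where "R t = fst (snd (\<eta> t))" for t
    define i where "i t = snd (snd (\<eta> t))" for t
    have eq: "\<eta> = (\<lambda>t. (D t, R t, i t))"
      by (simp add: D_def R_def i_def)
    have init': "D 0 = D0" "R 0 = R0" "i 0 = I0"
      using \<eta>(1) by (simp_all add: D_def R_def i_def)
    note sol = riccati_of_solution[OF J \<eta>(2)[unfolded eq] init']
    have "zof (D t) (R t) = Z t \<and> i t = I t"
      by (rule riccati_on_unique[OF J sol(1) riccati_on_subset[OF ric subset_UNIV] _ _ t])
        (simp_all add: 0 init' Y_eq)
    moreover have "D t = Dof X (zof (D t) (R t))" "R t = Rof X (zof (D t) (R t))"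
      using Dof_xof[of "D t" "R t"] Rof_xof[of "D t" "R t"] sol(2)[OF t] by simp_all
    ultimately show ?thesis
      by (simp add: eq)
  qed
  ultimately show ?thesis
    using sphere by (simp add: is_the_solution_def sphere_iff 0 Dof_init Rof_init) blast
qed

end

section \<open>Assembling the solution from the three signs of \<open>X\<^sup>2 - K\<close>\<close>

theorem proposition2p26:
  fixes p1 p2 p3 p4 p5 \<Theta> \<rho> D0 R0 I0 X Y K r :: real
  assumes "p1 > 0" and "p2 \<noteq> 0" and "p3 > 0" and "p1\<^sup>2 + p2\<^sup>2 = p3\<^sup>2"
    and "\<Theta> = arctan (p1 / (p2 + p3))"
    and "p4 > 0" and "p5 = p4 * tan \<Theta>" and "\<rho> > 0"
    and "(D0, R0, I0) \<in> S2 \<rho>"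
    and "X = 1 / (2 * sin \<Theta>) * D0 + 1 / (2 * cos \<Theta>) * R0 + p2 * p4 / (2 * p1 * p3 * cos \<Theta>) * \<rho>"
    and "Y = - (1 / (2 * sin \<Theta>)) * D0 + 1 / (2 * cos \<Theta>) * R0 - p4 / (2 * p1 * cos \<Theta>) * \<rho>"
    and "K = (1 - p4\<^sup>2 / (4 * p3\<^sup>2 * (cos \<Theta>)\<^sup>2)) * \<rho>\<^sup>2"
    and "r = sqrt \<bar>K - X\<^sup>2\<bar>"
  shows "let is_sol = (\<lambda>(Z :: real \<Rightarrow> real) (I :: real \<Rightarrow> real).
           is_the_solution (DRI_field p1 p2 p3 p4 p5 \<rho>) (S2 \<rho>) (D0, R0, I0)
             (\<lambda>t. (sin \<Theta> * (X - p2 * p4 / (2 * p1 * p3 * cos \<Theta>) * \<rho>) - sin \<Theta> * Z t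
                      - p5 / (2 * p1) * \<rho>,
                   cos \<Theta> * (X - p2 * p4 / (2 * p1 * p3 * cos \<Theta>) * \<rho>) + cos \<Theta> * Z t
                      + p4 / (2 * p1) * \<rho>,
                   I t)))
    in
      (X\<^sup>2 < K \<longrightarrow>
        (let W = (\<lambda>t. ((r - I0)\<^sup>2 + Y\<^sup>2) * exp (4 * p1 * r * t)
                    + ((r + I0)\<^sup>2 + Y\<^sup>2) * exp (- 4 * p1 * r * t)
                    - 2 * I0\<^sup>2 - 2 * Y\<^sup>2 + 2 * r\<^sup>2)
         in is_sol
              (\<lambda>t. 4 * r\<^sup>2 * Y / W t)
              (\<lambda>t. - r * ((((r - I0)\<^sup>2 + Y\<^sup>2) * exp (4 * p1 * r * t)
                          - ((r + I0)\<^sup>2 + Y\<^sup>2) * exp (- 4 * p1 * r * t)) / W t))))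
    \<and> (X\<^sup>2 = K \<longrightarrow>
        (let W = (\<lambda>t. (2 * p1 * t * (I0\<^sup>2 + Y\<^sup>2) - I0)\<^sup>2 + Y\<^sup>2)
         in is_sol
              (\<lambda>t. (I0\<^sup>2 + Y\<^sup>2) * Y / W t)
              (\<lambda>t. - ((I0\<^sup>2 + Y\<^sup>2) * (2 * p1 * t * (I0\<^sup>2 + Y\<^sup>2) - I0) / W t))))
    \<and> (X\<^sup>2 > K \<longrightarrow>
        (let W = (\<lambda>t. (I0\<^sup>2 + Y\<^sup>2 + r\<^sup>2) - 2 * r * I0 * sin (4 * p1 * r * t)
                    - (I0\<^sup>2 + Y\<^sup>2 - r\<^sup>2) * cos (4 * p1 * r * t))
         in is_sol
              (\<lambda>t. 2 * r\<^sup>2 * Y / W t)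
              (\<lambda>t. r * ((2 * r * I0 * cos (4 * p1 * r * t)
                          - (I0\<^sup>2 + Y\<^sup>2 - r\<^sup>2) * sin (4 * p1 * r * t)) / W t))))"
proof -
  interpret dri p1 p2 p3 p4 p5 \<Theta> \<rho> D0 R0 I0 X Y K
    using assms by unfold_locales
  have r: "r\<^sup>2 = \<bar>K - X\<^sup>2\<bar>"
    by (simp add: assms(13))
  have r_pos: "r > 0" if "X\<^sup>2 \<noteq> K"
    using that by (simp add: assms(13))
  have p: "p1 \<noteq> 0"
    using p1 by simp
  show ?thesis
    unfolding Let_def Dof_eq Rof_eq
  proof (intro conjI impI solution_of_riccati)
    assume "X\<^sup>2 < K"
    then have \<kappa>: "X\<^sup>2 - K = - r\<^sup>2" and pos: "r > 0"
      using r r_pos by auto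
    \<comment> \<open>At \<open>Y = 0\<close> the initial sphere relation collapses to
      \<open>I0\<^sup>2 + X\<^sup>2 - K = 0\<close>. The other two cases use this as well: it gives
      \<open>I0 = 0\<close> in the second and a contradiction in the third.\<close>
    have "I0\<^sup>2 = r\<^sup>2" if "Y = 0"
      using that init_eq \<kappa> by simp
    from riccati_on_negative[OF p pos this]
    show "riccati_on p1 (X\<^sup>2 - K) UNIV
        (\<lambda>t. 4 * r\<^sup>2 * Y / (((r - I0)\<^sup>2 + Y\<^sup>2) * exp (4 * p1 * r * t)
          + ((r + I0)\<^sup>2 + Y\<^sup>2) * exp (- 4 * p1 * r * t) - 2 * I0\<^sup>2 - 2 * Y\<^sup>2 + 2 * r\<^sup>2))
        (\<lambda>t. - r * ((((r - I0)\<^sup>2 + Y\<^sup>2) * exp (4 * p1 * r * t)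
          - ((r + I0)\<^sup>2 + Y\<^sup>2) * exp (- 4 * p1 * r * t))
          / (((r - I0)\<^sup>2 + Y\<^sup>2) * exp (4 * p1 * r * t)
          + ((r + I0)\<^sup>2 + Y\<^sup>2) * exp (- 4 * p1 * r * t) - 2 * I0\<^sup>2 - 2 * Y\<^sup>2 + 2 * r\<^sup>2)))"
      unfolding \<kappa> .
    have W0: "((r - I0)\<^sup>2 + Y\<^sup>2) * exp (4 * p1 * r * 0)
        + ((r + I0)\<^sup>2 + Y\<^sup>2) * exp (- 4 * p1 * r * 0) - 2 * I0\<^sup>2 - 2 * Y\<^sup>2 + 2 * r\<^sup>2 = 4 * r\<^sup>2"
      by (simp add: power2_eq_square algebra_simps)
    show "4 * r\<^sup>2 * Y / (((r - I0)\<^sup>2 + Y\<^sup>2) * exp (4 * p1 * r * 0)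
          + ((r + I0)\<^sup>2 + Y\<^sup>2) * exp (- 4 * p1 * r * 0) - 2 * I0\<^sup>2 - 2 * Y\<^sup>2 + 2 * r\<^sup>2) = Y"
      unfolding W0 using pos by simp
    show "- r * ((((r - I0)\<^sup>2 + Y\<^sup>2) * exp (4 * p1 * r * 0)
          - ((r + I0)\<^sup>2 + Y\<^sup>2) * exp (- 4 * p1 * r * 0))
          / (((r - I0)\<^sup>2 + Y\<^sup>2) * exp (4 * p1 * r * 0)
          + ((r + I0)\<^sup>2 + Y\<^sup>2) * exp (- 4 * p1 * r * 0) - 2 * I0\<^sup>2 - 2 * Y\<^sup>2 + 2 * r\<^sup>2)) = I0"
      unfolding W0 using pos by (simp add: field_simps power2_eq_square)
  next
    assume "X\<^sup>2 = K"
    then have \<kappa>: "X\<^sup>2 - K = 0" by simp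
    have Y0: "I0 = 0" if "Y = 0"
      using that init_eq \<kappa> by simp
    from riccati_on_zero[OF p this]
    show "riccati_on p1 (X\<^sup>2 - K) UNIV
        (\<lambda>t. (I0\<^sup>2 + Y\<^sup>2) * Y / ((2 * p1 * t * (I0\<^sup>2 + Y\<^sup>2) - I0)\<^sup>2 + Y\<^sup>2))
        (\<lambda>t. - ((I0\<^sup>2 + Y\<^sup>2) * (2 * p1 * t * (I0\<^sup>2 + Y\<^sup>2) - I0)
          / ((2 * p1 * t * (I0\<^sup>2 + Y\<^sup>2) - I0)\<^sup>2 + Y\<^sup>2)))"
      unfolding \<kappa> .
    show "(I0\<^sup>2 + Y\<^sup>2) * Y / ((2 * p1 * 0 * (I0\<^sup>2 + Y\<^sup>2) - I0)\<^sup>2 + Y\<^sup>2) = Y"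
      "- ((I0\<^sup>2 + Y\<^sup>2) * (2 * p1 * 0 * (I0\<^sup>2 + Y\<^sup>2) - I0)
          / ((2 * p1 * 0 * (I0\<^sup>2 + Y\<^sup>2) - I0)\<^sup>2 + Y\<^sup>2)) = I0"
      \<comment> \<open>If \<open>Y = 0\<close> then \<open>I0 = 0\<close>, and the value 0 of 0/0
        is the correct initial value; otherwise \<open>W(0) = I0\<^sup>2 + Y\<^sup>2\<close> is
        nonzero and cancels.\<close>
      using Y0 by (auto simp: sum_power2_eq_zero_iff)
  next
    assume "X\<^sup>2 > K"
    then have \<kappa>: "X\<^sup>2 - K = r\<^sup>2" and pos: "r > 0"
      using r r_pos by auto
    have "Y \<noteq> 0"
    proof
      assume "Y = 0"
      with init_eq \<kappa> have "I0\<^sup>2 + r\<^sup>2 = 0" by simp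
      with pos show False by (simp add: sum_power2_eq_zero_iff)
    qed
    from riccati_on_positive[OF p pos this]
    show "riccati_on p1 (X\<^sup>2 - K) UNIV
        (\<lambda>t. 2 * r\<^sup>2 * Y / ((I0\<^sup>2 + Y\<^sup>2 + r\<^sup>2) - 2 * r * I0 * sin (4 * p1 * r * t)
          - (I0\<^sup>2 + Y\<^sup>2 - r\<^sup>2) * cos (4 * p1 * r * t)))
        (\<lambda>t. r * ((2 * r * I0 * cos (4 * p1 * r * t)
          - (I0\<^sup>2 + Y\<^sup>2 - r\<^sup>2) * sin (4 * p1 * r * t))
          / ((I0\<^sup>2 + Y\<^sup>2 + r\<^sup>2) - 2 * r * I0 * sin (4 * p1 * r * t)
          - (I0\<^sup>2 + Y\<^sup>2 - r\<^sup>2) * cos (4 * p1 * r * t))))"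
      unfolding \<kappa> .
    show "2 * r\<^sup>2 * Y / ((I0\<^sup>2 + Y\<^sup>2 + r\<^sup>2) - 2 * r * I0 * sin (4 * p1 * r * 0)
          - (I0\<^sup>2 + Y\<^sup>2 - r\<^sup>2) * cos (4 * p1 * r * 0)) = Y"
      using pos by simp
    show "r * ((2 * r * I0 * cos (4 * p1 * r * 0)
          - (I0\<^sup>2 + Y\<^sup>2 - r\<^sup>2) * sin (4 * p1 * r * 0))
          / ((I0\<^sup>2 + Y\<^sup>2 + r\<^sup>2) - 2 * r * I0 * sin (4 * p1 * r * 0)
          - (I0\<^sup>2 + Y\<^sup>2 - r\<^sup>2) * cos (4 * p1 * r * 0))) = I0"
      using pos by (simp add: field_simps power2_eq_square)
  qed
qed

end
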